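(* Let $n,k\in\mathbb{N}$ and let $\mathbf{V}=\{(x_1,\dots,x_n)\in\mathbb{R}^n: x_1+\dots+x_n=0\}$. There is a bijection between the maximal nilpotent subsemigroups of a given nilpotency class, $k$, in $\mathbf{D}_n$ and the flags of length $k$ in the $(n-1)$-dimensional real vector space $\mathbf{V}$. In particular, the maximal nilpotent subsemigroups in $\mathbf{D}_n$ correspond to complete flags $0=V_0\subsetneqq V_1\subsetneqq\dots\subsetneqq V_{n-1}=\mathbf{V}$.
   Context: $\mathbb{N}=\{1,2,3,\dots\}$. $\mathbf{D}_n$ is the semigroup (under matrix multiplication) of doubly stochastic real $n\times n$ matrices, i.e. matrices with non-negative entries all of whose row sums and column sums equal $1$. Its zero element is the matrix $\mathbb{O}_n$ all of whose entries equal $1/n$. A flag of length $k$ in $\mathbf{V}$ is a chain of linear subspaces $0=V_0\subsetneqq V_1\subsetneqq\dots\subsetneqq V_k=\mathbf{V}$; it is complete if $k=\dim\mathbf{V}$. Let $S$ be a semigroup with zero element $0$. A subsemigroup $T\subset S$ is nilpotent if there is $k\in\mathbb{N}$ with $T^k=\{0\}$ (every product of $k$ elements of $T$ equals $0$); the minimal such $k$ is the nilpotency class of $T$. $\mathrm{Nil}_m(S)$ denotes the set of all nilpotent subsemigroups of $S$ of nilpotency class at most $m$, and $\mathrm{Nil}(S)=\bigcup_{m\in\mathbb{N}}\mathrm{Nil}_m(S)$. The maximal elements of $\mathrm{Nil}_m(S)$ with respect to inclusion are called maximal nilpotent subsemigroups of nilpotency class $m$ of $S$. The maximal elements of $\mathrm{Nil}(S)$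 with respect to inclusion are called maximal nilpotent subsemigroups of $S$.
   Formalization: The bijection with the maximal elements of Nil_k(D_n) is asserted for k ≤ n−1 only (for k > n−1 there are no flags of length k, yet such maximal elements exist, e.g. {O_2} for n=k=2); for n ≥ 2 and all k it is asserted for those of class exactly k. *)

theory Defs
  imports "HOL-Analysis.Analysis"
begin

section \<open>Nilpotent subsemigroups of a semigroup with zero\<close>

text \<open>
  A semigroup with zero is given by a carrier \<open>S\<close>, a binary operation \<open>m\<close> and a zero element \<open>z\<close>.
  Explicit operations are used because the type-class product on \<open>real ^ 'n ^ 'n\<close> is the
  entrywise one.
\<close>

definition semigroup_with_zero :: "'a set \<Rightarrow> ('a \<Rightarrow> 'a \<Rightarrow> 'a) \<Rightarrow> 'a \<Rightarrow> bool" where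
  "semigroup_with_zero S m z \<longleftrightarrow>
     (\<forall>x\<in>S. \<forall>y\<in>S. m x y \<in> S) \<and>
     (\<forall>x\<in>S. \<forall>y\<in>S. \<forall>w\<in>S. m (m x y) w = m x (m y w)) \<and>
     z \<in> S \<and> (\<forall>x\<in>S. m x z = z \<and> m z x = z)"

definition subsemigroup :: "'a set \<Rightarrow> ('a \<Rightarrow> 'a \<Rightarrow> 'a) \<Rightarrow> 'a set \<Rightarrow> bool" where
  "subsemigroup S m T \<longleftrightarrow> T \<subseteq> S \<and> T \<noteq> {} \<and> (\<forall>x\<in>T. \<forall>y\<in>T. m x y \<in> T)"

text \<open>\<open>set_power m T k\<close> is the set of all products of \<open>k\<close> elements of \<open>T\<close>; the value at
  \<open>k = 0\<close> is a dummy, as a semigroup has no empty product.\<close>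

fun set_power :: "('a \<Rightarrow> 'a \<Rightarrow> 'a) \<Rightarrow> 'a set \<Rightarrow> nat \<Rightarrow> 'a set" where
  "set_power m T 0 = {}"
| "set_power m T (Suc 0) = T"
| "set_power m T (Suc (Suc k)) = {m x y | x y. x \<in> set_power m T (Suc k) \<and> y \<in> T}"

definition nilpotent_subsemigroup ::
    "'a set \<Rightarrow> ('a \<Rightarrow> 'a \<Rightarrow> 'a) \<Rightarrow> 'a \<Rightarrow> 'a set \<Rightarrow> bool" where
  "nilpotent_subsemigroup S m z T \<longleftrightarrow>
     subsemigroup S m T \<and> (\<exists>k\<ge>1. set_power m T k = {z})"

definition nilpotency_class :: "('a \<Rightarrow> 'a \<Rightarrow> 'a) \<Rightarrow> 'a \<Rightarrow> 'a set \<Rightarrow> nat" where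
  "nilpotency_class m z T = (LEAST k. k \<ge> 1 \<and> set_power m T k = {z})"

definition Nil_class :: "'a set \<Rightarrow> ('a \<Rightarrow> 'a \<Rightarrow> 'a) \<Rightarrow> 'a \<Rightarrow> nat \<Rightarrow> 'a set set" where
  "Nil_class S m z k = {T. nilpotent_subsemigroup S m z T \<and> nilpotency_class m z T \<le> k}"

definition Nil_all :: "'a set \<Rightarrow> ('a \<Rightarrow> 'a \<Rightarrow> 'a) \<Rightarrow> 'a \<Rightarrow> 'a set set" where
  "Nil_all S m z = (\<Union>k\<in>{1..}. Nil_class S m z k)"

definition maximal_elements :: "'a set set \<Rightarrow> 'a set set" where
  "maximal_elements \<C> = {T \<in> \<C>. \<forall>U\<in>\<C>. T \<subseteq> U \<longrightarrow> U = T}"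


section \<open>Flags\<close>

text \<open>A flag of length \<open>k\<close> is the list \<open>[V\<^sub>0, \<dots>, V\<^sub>k]\<close>, which has \<open>k + 1\<close> entries.\<close>

definition flags :: "'a::real_vector set \<Rightarrow> nat \<Rightarrow> 'a set list set" where
  "flags V k = {Vs. length Vs = Suc k \<and> (\<forall>W\<in>set Vs. subspace W) \<and>
                    Vs ! 0 = {0} \<and> Vs ! k = V \<and> (\<forall>i<k. Vs ! i \<subset> Vs ! Suc i)}"

definition complete_flags :: "'a::real_vector set \<Rightarrow> 'a set list set" where
  "complete_flags V = flags V (dim V)"


section \<open>Doubly stochastic matrices\<close>

text \<open>The size of the matrices is \<open>n = CARD('n)\<close>.\<close>

definition doubly_stochastic :: "(real ^ 'n ^ 'n) set" where
  "doubly_stochastic = {A. (\<forall>i j. A $ i $ j \<ge> 0) \<and>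
     (\<forall>i. (\<Sum>j\<in>UNIV. A $ i $ j) = 1) \<and> (\<forall>j. (\<Sum>i\<in>UNIV. A $ i $ j) = 1)}"

definition uniform_matrix :: "real ^ 'n ^ 'n" where
  "uniform_matrix = (\<chi> i j. 1 / real CARD('n))"

definition sum_zero_space :: "(real ^ 'n) set" where
  "sum_zero_space = {x. (\<Sum>i\<in>UNIV. x $ i) = 0}"

lemma semigroup_with_zero_doubly_stochastic:
  "semigroup_with_zero (doubly_stochastic :: (real ^ 'n ^ 'n) set) (**) uniform_matrix"
proof -
  have rows: "(\<Sum>j\<in>UNIV. (A ** B) $ i $ j) = 1"
    if "A \<in> doubly_stochastic" "B \<in> doubly_stochastic" for A B :: "real ^ 'n ^ 'n" and i
  proof -
    have "(\<Sum>j\<in>UNIV. (A ** B) $ i $ j) = (\<Sum>k\<in>UNIV. \<Sum>j\<in>UNIV. A $ i $ k * B $ k $ j)"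
      unfolding matrix_matrix_mult_def by (simp, rule sum.swap)
    then show ?thesis
      using that by (simp add: doubly_stochastic_def flip: sum_distrib_left)
  qed
  have cols: "(\<Sum>i\<in>UNIV. (A ** B) $ i $ j) = 1"
    if "A \<in> doubly_stochastic" "B \<in> doubly_stochastic" for A B :: "real ^ 'n ^ 'n" and j
  proof -
    have "(\<Sum>i\<in>UNIV. (A ** B) $ i $ j) = (\<Sum>k\<in>UNIV. \<Sum>i\<in>UNIV. A $ i $ k * B $ k $ j)"
      unfolding matrix_matrix_mult_def by (simp, rule sum.swap)
    then show ?thesis
      using that by (simp add: doubly_stochastic_def flip: sum_distrib_right)
  qed
  have "A ** B \<in> doubly_stochastic"
    if "A \<in> doubly_stochastic" "B \<in> doubly_stochastic" for A B :: "real ^ 'n ^ 'n"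
    using rows[OF that] cols[OF that] that
    by (auto simp: doubly_stochastic_def matrix_matrix_mult_def intro!: sum_nonneg)
  moreover have "A ** uniform_matrix = uniform_matrix \<and> uniform_matrix ** A = uniform_matrix"
    if "A \<in> doubly_stochastic" for A :: "real ^ 'n ^ 'n"
    using that
    by (simp add: doubly_stochastic_def uniform_matrix_def matrix_matrix_mult_def vec_eq_iff
        flip: sum_distrib_left sum_divide_distrib)
  moreover have "uniform_matrix \<in> (doubly_stochastic :: (real ^ 'n ^ 'n) set)"
    by (simp add: doubly_stochastic_def uniform_matrix_def)
  ultimately show ?thesis
    by (simp add: semigroup_with_zero_def matrix_mul_assoc)
qed

text \<open>
  The correspondence: a flag \<open>V\<^sub>0 \<subset> \<dots> \<subset> V\<^sub>k\<close> is sent to the set of all doubly stochastic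
  matrices \<open>A\<close> (acting on column vectors) such that \<open>A V\<^sub>i \<subseteq> V\<^bsub>i-1\<^esub>\<close> for \<open>i = 1, \<dots>, k\<close>.
\<close>

definition flag_semigroup :: "(real ^ 'n) set list \<Rightarrow> (real ^ 'n ^ 'n) set" where
  "flag_semigroup Vs =
     {A \<in> doubly_stochastic. \<forall>i. Suc i < length Vs \<longrightarrow> (\<lambda>x. A *v x) ` (Vs ! Suc i) \<subseteq> Vs ! i}"

end

theory Submission
  imports Defs
begin

text \<open>
  A nilpotent \<open>T\<close> yields the strictly increasing chain \<open>V\<^sub>i = {v \<in> V. T\<^sup>i v = 0}\<close>, so \<open>T\<close> lies in
  the semigroup of a flag, and refining a flag only enlarges its semigroup.  Conversely, if
  \<open>x \<in> V\<^sub>i\<close> and \<open>u \<in> V\<close> is orthogonal to \<open>V\<^sub>i\<close>, then the uniform matrix plus a small multiple of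
  the rank-one matrix \<open>x u\<^sup>T\<close> lies in the semigroup of the flag.  These matrices show
  that an inclusion between semigroups of flags of equal length forces the flags to be equal,
  which gives both injectivity and maximality.
\<close>

section \<open>The sum-zero space and the action of doubly stochastic matrices on it\<close>

lemma sum_zero_space_eq_hyperplane: "sum_zero_space = {x :: real ^ 'n. 1 \<bullet> x = 0}"
  by (simp add: sum_zero_space_def inner_vec_def)

lemma subspace_sum_zero_space: "subspace (sum_zero_space :: (real ^ 'n) set)"
  unfolding sum_zero_space_eq_hyperplane by (rule subspace_hyperplane)

lemma dim_sum_zero_space: "dim (sum_zero_space :: (real ^ 'n) set) = CARD('n) - 1"
proof -
  have "(1 :: real ^ 'n) \<noteq> 0"
    by (simp add: vec_eq_iff)
  then show ?thesis
    unfolding sum_zero_space_eq_hyperplane by (simp add: dim_hyperplane)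
qed

lemma uniform_matrix_mult_sum_zero:
  "x \<in> sum_zero_space \<Longrightarrow> uniform_matrix *v x = (0 :: real ^ 'n)"
  by (simp add: sum_zero_space_def uniform_matrix_def matrix_vector_mult_def vec_eq_iff
      flip: sum_divide_distrib)

lemma doubly_stochastic_mult_sum_zero:
  assumes "A \<in> doubly_stochastic" "x \<in> (sum_zero_space :: (real ^ 'n) set)"
  shows "A *v x \<in> sum_zero_space"
proof -
  have "(\<Sum>i\<in>UNIV. (A *v x) $ i) = (\<Sum>j\<in>UNIV. \<Sum>i\<in>UNIV. A $ i $ j * x $ j)"
    unfolding matrix_vector_mult_def by (simp, rule sum.swap)
  also have "\<dots> = 0"
    using assms by (simp add: doubly_stochastic_def sum_zero_space_def flip: sum_distrib_right)
  finally show ?thesis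
    by (simp add: sum_zero_space_def)
qed

text \<open>Differences of standard basis vectors have sum zero, so killing them makes all columns
  of \<open>A\<close> equal; the row sums then force every entry to be 1/n. This turns vanishing on
  the sum-zero space into equality with the zero element.\<close>

lemma doubly_stochastic_eq_uniform:
  fixes A :: "real ^ 'n ^ 'n"
  assumes A: "A \<in> doubly_stochastic" and kill: "\<And>x. x \<in> sum_zero_space \<Longrightarrow> A *v x = 0"
  shows "A = uniform_matrix"
proof -
  have eq: "A $ i $ j = A $ i $ l" for i j l
  proof -
    have "axis j 1 - axis l 1 \<in> (sum_zero_space :: (real ^ 'n) set)"
      by (simp add: sum_zero_space_eq_hyperplane inner_diff_right inner_axis)
    from kill[OF this] have "A *v axis j 1 = A *v axis l 1"
      by (simp add: matrix_vector_mult_diff_distrib)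
    then have "(A *v axis j 1) $ i = (A *v axis l 1) $ i"
      by simp
    then show ?thesis
      by (simp add: matrix_vector_mul_component inner_axis)
  qed
  have "A $ i $ j = 1 / real CARD('n)" for i j
  proof -
    have "1 = (\<Sum>l\<in>UNIV. A $ i $ l)"
      using A by (simp add: doubly_stochastic_def)
    also have "\<dots> = (\<Sum>l\<in>(UNIV :: 'n set). A $ i $ j)"
      by (intro sum.cong eq refl)
    finally show ?thesis
      by (simp add: field_simps)
  qed
  then show ?thesis
    by (simp add: vec_eq_iff uniform_matrix_def)
qed

text \<open>The matrix is the uniform one plus e times the rank-one matrix with entries x_i u_j. Row
  sums survive because \<open>u\<close> has sum zero, column sums because \<open>x\<close> has, and
  on the sum-zero space only the rank-one part acts.\<close>

lemma doubly_stochastic_rank_one_perturbation: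
  fixes x u :: "real ^ 'n"
  assumes x: "x \<in> sum_zero_space" and u: "u \<in> sum_zero_space"
  obtains A e where "A \<in> doubly_stochastic" "e > 0"
    "\<And>v. v \<in> sum_zero_space \<Longrightarrow> A *v v = (e * (u \<bullet> v)) *\<^sub>R x"
proof -
  \<comment> \<open>Small enough that e |x_i u_j| never exceeds 1/n, since |x_i u_j| is at most
    \<open>norm x * norm u\<close>; the summand 1 keeps the denominator positive when
    \<open>x\<close> or \<open>u\<close> is zero.\<close>
  define e where "e = 1 / (real CARD('n) * (1 + norm x * norm u))"
  define A :: "real ^ 'n ^ 'n" where "A = (\<chi> i j. 1 / real CARD('n) + e * x $ i * u $ j)"
  have pos: "1 + norm x * norm u > 0"
    by (smt (verit) mult_nonneg_nonneg norm_ge_zero)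
  then have e: "e > 0"
    by (simp add: e_def)
  have "A $ i $ j \<ge> 0" for i j
  proof -
    have "\<bar>x $ i * u $ j\<bar> \<le> norm x * norm u"
      by (simp add: abs_mult mult_mono component_le_norm_cart)
    then have "- (1 + norm x * norm u) \<le> x $ i * u $ j"
      by linarith
    then have "e * - (1 + norm x * norm u) \<le> e * (x $ i * u $ j)"
      using e by (intro mult_left_mono) auto
    moreover have "e * - (1 + norm x * norm u) = - (1 / real CARD('n))"
      using pos unfolding e_def by (metis (no_types, lifting) less_irrefl mult_minus_right
          nonzero_mult_divide_mult_cancel_right mult_1 times_divide_eq_left)
    ultimately show ?thesis
      by (simp add: A_def mult.assoc)
  qed
  moreover have "(\<Sum>j\<in>UNIV. A $ i $ j) = 1" for i
    using u by (simp add: A_def sum.distrib sum_zero_space_def flip: sum_distrib_left)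
  moreover have "(\<Sum>i\<in>UNIV. A $ i $ j) = 1" for j
    using x by (simp add: A_def sum.distrib sum_zero_space_def mult.assoc
        flip: sum_distrib_left sum_distrib_right)
  ultimately have "A \<in> doubly_stochastic"
    by (simp add: doubly_stochastic_def)
  moreover have "A *v v = (e * (u \<bullet> v)) *\<^sub>R x" if v: "v \<in> sum_zero_space" for v
  proof -
    have "(\<Sum>j\<in>UNIV. A $ i $ j * v $ j)
        = (\<Sum>j\<in>UNIV. v $ j) / real CARD('n) + e * x $ i * (\<Sum>j\<in>UNIV. u $ j * v $ j)" for i
      by (simp add: A_def algebra_simps sum.distrib sum_divide_distrib sum_distrib_left)
    then show ?thesis
      using v by (simp add: vec_eq_iff matrix_vector_mult_def sum_zero_space_def inner_vec_def)
  qed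
  ultimately show ?thesis
    using that e by blast
qed

section \<open>Elementary facts about flags\<close>

lemma flags_length: "Vs \<in> flags V k \<Longrightarrow> length Vs = Suc k"
  by (simp add: flags_def)

lemma flags_subspace: "Vs \<in> flags V k \<Longrightarrow> i \<le> k \<Longrightarrow> subspace (Vs ! i)"
  by (simp add: flags_def)

lemma flags_first: "Vs \<in> flags V k \<Longrightarrow> Vs ! 0 = {0}"
  by (simp add: flags_def)

lemma flags_last: "Vs \<in> flags V k \<Longrightarrow> Vs ! k = V"
  by (simp add: flags_def)

lemma flags_step: "Vs \<in> flags V k \<Longrightarrow> i < k \<Longrightarrow> Vs ! i \<subset> Vs ! Suc i"
  by (simp add: flags_def)

lemma flags_mono:
  assumes Vs: "Vs \<in> flags V k" and "i \<le> j" "j \<le> k"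
  shows "Vs ! i \<subseteq> Vs ! j"
  using assms(2,3)
proof (induction j rule: dec_induct)
  case (step j)
  then show ?case
    using flags_step[OF Vs, of j] by auto
qed simp

lemma flags_length_le_dim:
  fixes V :: "'a :: euclidean_space set"
  assumes Vs: "Vs \<in> flags V k"
  shows "k \<le> dim V"
proof -
  have "i \<le> dim (Vs ! i)" if "i \<le> k" for i
    using that
  proof (induction i)
    case (Suc i)
    then have "dim (Vs ! i) < dim (Vs ! Suc i)"
      by (metis Suc_leD Suc_le_lessD Vs dim_psubset flags_step flags_subspace span_eq_iff)
    with Suc show ?case
      by simp
  qed simp
  then show ?thesis
    using flags_last[OF Vs] by blast
qed

lemma map_in_flagsI:
  assumes "\<And>i. i \<le> k \<Longrightarrow> subspace (f i)" "f 0 = {0}" "f k = V" "\<And>i. i < k \<Longrightarrow> f i \<subset> f (Suc i)"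
  shows "map f [0..<Suc k] \<in> flags V k"
  using assms by (auto simp: flags_def nth_append simp del: upt_Suc)

section \<open>Inclusions between semigroups of flags\<close>

lemma flag_semigroupD:
  assumes "Vs \<in> flags V k" "A \<in> flag_semigroup Vs" "i < k" "x \<in> Vs ! Suc i"
  shows "A *v x \<in> Vs ! i"
  using assms by (auto simp: flag_semigroup_def flags_length)

lemma flag_semigroupI:
  assumes "Vs \<in> flags V k" "A \<in> doubly_stochastic"
    "\<And>i x. i < k \<Longrightarrow> x \<in> Vs ! Suc i \<Longrightarrow> A *v x \<in> Vs ! i"
  shows "A \<in> flag_semigroup Vs"
  using assms by (auto simp: flag_semigroup_def flags_length)

text \<open>The semigroup is rich enough to move any vector outside V_i onto the line of any
  prescribed vector of V_i. This is the only source of elements in the comparison of flags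
  below.\<close>

lemma flag_semigroup_transitive:
  fixes x y :: "real ^ 'n"
  assumes Vs: "Vs \<in> flags sum_zero_space k" and i: "i \<le> k"
    and x: "x \<in> Vs ! i" and y: "y \<in> sum_zero_space - Vs ! i"
  obtains A c where "A \<in> flag_semigroup Vs" "c \<noteq> 0" "A *v y = c *\<^sub>R x"
proof -
  have sub: "subspace (Vs ! i)"
    using Vs i by (rule flags_subspace)
  have Vj: "Vs ! j \<subseteq> sum_zero_space" if "j \<le> k" for j
    using flags_mono[OF Vs that] flags_last[OF Vs] by simp
  \<comment> \<open>\<open>u\<close> is the component of \<open>y\<close> orthogonal to V_i: nonzero
    because \<open>y\<close> lies outside V_i, and of sum zero because \<open>y\<close> and
    \<open>p\<close> are. The matrix built from \<open>x\<close> and \<open>u\<close> kills V_i but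
    not \<open>y\<close>.\<close>
  obtain p u where p: "p \<in> span (Vs ! i)" and u: "\<And>w. w \<in> span (Vs ! i) \<Longrightarrow> orthogonal u w"
    and ypu: "y = p + u"
    using orthogonal_subspace_decomp_exists[of "Vs ! i" y] by blast
  have p: "p \<in> Vs ! i"
    using p span_eq_iff[THEN iffD2, OF sub] by simp
  have u: "u \<bullet> w = 0" if "w \<in> Vs ! i" for w
    using u[OF span_base[OF that]] by (simp add: orthogonal_def)
  have u0: "u \<noteq> 0"
    using ypu p y by auto
  have "u = y - p"
    using ypu by simp
  also have "\<dots> \<in> sum_zero_space"
    using y p Vj[OF i] by (intro subspace_diff[OF subspace_sum_zero_space]) auto
  finally have uV: "u \<in> sum_zero_space" .
  obtain A e where A: "A \<in> doubly_stochastic" "e > 0"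
    and Av: "\<And>v. v \<in> sum_zero_space \<Longrightarrow> A *v v = (e * (u \<bullet> v)) *\<^sub>R x"
    using doubly_stochastic_rank_one_perturbation[OF subsetD[OF Vj[OF i] x] uV] by blast
  have "A \<in> flag_semigroup Vs"
  proof (rule flag_semigroupI[OF Vs A(1)])
    fix j v assume j: "j < k" and v: "v \<in> Vs ! Suc j"
    have Avx: "A *v v = (e * (u \<bullet> v)) *\<^sub>R x"
      using Av Vj[of "Suc j"] j v by auto
    \<comment> \<open>Members of the flag up to V_i are killed by \<open>A\<close>; a larger V_(j+1)
      is sent into the line of \<open>x\<close>, which lies in V_i and so in V_j.\<close>
    show "A *v v \<in> Vs ! j"
    proof (cases "Suc j \<le> i")
      case True
      then have "u \<bullet> v = 0"
        using u flags_mono[OF Vs True i] v by auto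
      then show ?thesis
        using Avx flags_subspace[OF Vs, of j] j by (simp add: subspace_0)
    next
      case False
      then have "x \<in> Vs ! j"
        using flags_mono[OF Vs, of i j] x j by auto
      then show ?thesis
        using Avx flags_subspace[OF Vs, of j] j by (simp add: subspace_scale)
    qed
  qed
  moreover have "u \<bullet> y = u \<bullet> u"
    using u[OF p] by (simp add: ypu inner_add_right)
  then have "e * (u \<bullet> y) \<noteq> 0"
    using u0 A(2) by simp
  ultimately show ?thesis
    using that Av y by blast
qed

text \<open>Induction downwards from the top, where both flags equal the whole space. A vector
  \<open>y\<close> of V_(k-j) outside V_(k-j-1) can be moved by the smaller semigroup onto any line
  of V_(k-j-1); since \<open>y\<close> is in W_(l-j), the result is in W_(l-j-1). Counting from the
  top lets the lengths differ, which the computation of the nilpotency class uses.\<close>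

lemma flag_semigroup_subset_nth:
  fixes Vs Ws :: "(real ^ 'n) set list"
  assumes Vs: "Vs \<in> flags sum_zero_space k" and Ws: "Ws \<in> flags sum_zero_space l"
    and sub: "flag_semigroup Vs \<subseteq> flag_semigroup Ws"
    and "j \<le> k" "j \<le> l"
  shows "Vs ! (k - j) \<subseteq> Ws ! (l - j)"
  using assms(4,5)
proof (induction j)
  case 0
  then show ?case
    using flags_last[OF Vs] flags_last[OF Ws] by simp
next
  case (Suc j)
  have IH: "Vs ! (k - j) \<subseteq> Ws ! (l - j)"
    using Suc by simp
  have k: "Suc (k - Suc j) = k - j" and l: "Suc (l - Suc j) = l - j"
    using Suc.prems by auto
  obtain y where y: "y \<in> Vs ! (k - j)" "y \<notin> Vs ! (k - Suc j)"
    using flags_step[OF Vs, of "k - Suc j"] Suc.prems unfolding k by auto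
  have yV: "y \<in> sum_zero_space"
    using flags_mono[OF Vs, of "k - j" k] flags_last[OF Vs] y by auto
  show ?case
  proof
    fix x assume "x \<in> Vs ! (k - Suc j)"
    then obtain A c where A: "A \<in> flag_semigroup Vs" "c \<noteq> 0" "A *v y = c *\<^sub>R x"
      using flag_semigroup_transitive[OF Vs, of "k - Suc j" x y] y yV by auto
    have "A *v y \<in> Ws ! (l - Suc j)"
      using A(1) sub IH y Suc.prems l by (intro flag_semigroupD[OF Ws]) auto
    then show "x \<in> Ws ! (l - Suc j)"
      using A subspace_scale[OF flags_subspace[OF Ws], of "l - Suc j" "c *\<^sub>R x" "inverse c"] by simp
  qed
qed

text \<open>Comparison from the top gives V_i inside W_i. The reverse inclusion goes upwards from
  the bottom, where both flags are zero, and uses that the lengths agree.\<close>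

lemma flag_semigroup_subset_imp_eq:
  fixes Vs Ws :: "(real ^ 'n) set list"
  assumes Vs: "Vs \<in> flags sum_zero_space k" and Ws: "Ws \<in> flags sum_zero_space k"
    and sub: "flag_semigroup Vs \<subseteq> flag_semigroup Ws"
  shows "Vs = Ws"
proof -
  have le: "Vs ! i \<subseteq> Ws ! i" if "i \<le> k" for i
    using flag_semigroup_subset_nth[OF Vs Ws sub, of "k - i"] that by simp
  have ge: "Ws ! i \<subseteq> Vs ! i" if "i \<le> k" for i
    using that
  proof (induction i)
    case 0
    then show ?case
      using flags_first[OF Vs] flags_first[OF Ws] by simp
  next
    case (Suc i)
    show ?case
    proof (rule ccontr)
      assume "\<not> ?thesis"
      then obtain w where w: "w \<in> Ws ! Suc i" "w \<notin> Vs ! Suc i"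
        by blast
      have wV: "w \<in> sum_zero_space"
        using flags_mono[OF Ws, of "Suc i" k] flags_last[OF Ws] Suc.prems w by auto
      \<comment> \<open>\<open>w\<close> can be moved onto any line of V_(i+1), and the images lie
        in W_i. By induction W_i is inside V_i, so V_(i+1) would be inside V_i, against
        strictness.\<close>
      have "Vs ! Suc i \<subseteq> Ws ! i"
      proof
        fix x assume "x \<in> Vs ! Suc i"
        then obtain A c where A: "A \<in> flag_semigroup Vs" "c \<noteq> 0" "A *v w = c *\<^sub>R x"
          using flag_semigroup_transitive[OF Vs Suc.prems, of x w] w wV by auto
        have "A *v w \<in> Ws ! i"
          using A(1) sub w Suc.prems by (intro flag_semigroupD[OF Ws]) auto
        then show "x \<in> Ws ! i"
          using A subspace_scale[OF flags_subspace[OF Ws], of i "c *\<^sub>R x" "inverse c"] Suc.prems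
          by simp
      qed
      then show False
        using Suc flags_step[OF Vs, of i] by auto
    qed
  qed
  have "Vs ! i = Ws ! i" if "i < length Vs" for i
    using le[of i] ge[of i] that flags_length[OF Vs] by auto
  then show ?thesis
    using flags_length[OF Vs] flags_length[OF Ws] by (simp add: list_eq_iff_nth_eq)
qed

section \<open>Powers of a set, and nilpotency of the semigroup of a flag\<close>

lemma set_power_Suc: "j \<ge> 1 \<Longrightarrow> set_power m T (Suc j) = {m x y | x y. x \<in> set_power m T j \<and> y \<in> T}"
  by (cases j) auto

lemma set_power_mono: "T \<subseteq> U \<Longrightarrow> set_power m T j \<subseteq> set_power m U j"
proof (induction m T j rule: set_power.induct)
  case (3 m T j)
  then show ?case
    by (auto simp: subset_iff)
qed auto

lemma set_power_nonempty: "T \<noteq> {} \<Longrightarrow> j \<ge> 1 \<Longrightarrow> set_power m T j \<noteq> {}"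
proof (induction j)
  case (Suc j)
  then show ?case
    by (cases "j = 0") (auto simp: set_power_Suc)
qed simp

lemma set_power_subset_carrier:
  assumes "semigroup_with_zero S m z" "T \<subseteq> S"
  shows "set_power m T j \<subseteq> S"
proof (induction j)
  case (Suc j)
  then show ?case
    using assms by (cases "j = 0") (auto simp: set_power_Suc semigroup_with_zero_def)
qed simp

lemma flag_semigroup_subset: "flag_semigroup Vs \<subseteq> doubly_stochastic"
  by (auto simp: flag_semigroup_def)

text \<open>Each factor lowers the level by one. Truncated subtraction is right here: once at level
  0, a vector is zero and stays there.\<close>

lemma set_power_flag_semigroup_mult:
  assumes Vs: "Vs \<in> flags sum_zero_space k" and "j \<ge> 1" "i \<le> k"
    and "P \<in> set_power (**) (flag_semigroup Vs) j" "x \<in> Vs ! i"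
  shows "P *v x \<in> Vs ! (i - j)"
proof -
  have step: "A *v y \<in> Vs ! (l - 1)" if A: "A \<in> flag_semigroup Vs" and "l \<le> k" "y \<in> Vs ! l"
    for A y l
  proof (cases l)
    case 0
    then show ?thesis
      using that flags_first[OF Vs] by simp
  next
    case (Suc l')
    then show ?thesis
      using that by (auto intro: flag_semigroupD[OF Vs A])
  qed
  show ?thesis
    using assms(2-5)
  proof (induction j arbitrary: i x P)
    case (Suc j)
    show ?case
    proof (cases "j = 0")
      case True
      then show ?thesis
        using Suc.prems step by simp
    next
      case False
      then obtain Q A where Q: "Q \<in> set_power (**) (flag_semigroup Vs) j"
        and A: "A \<in> flag_semigroup Vs" and P: "P = Q ** A"
        using Suc.prems by (auto simp: set_power_Suc)
      \<comment> \<open>The rightmost factor \<open>A\<close> acts first and costs one level; the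
        induction hypothesis applies to \<open>Q\<close> from level i - 1.\<close>
      have "Q *v (A *v x) \<in> Vs ! ((i - 1) - j)"
        using step[OF A] Suc.prems False by (intro Suc.IH Q) auto
      then show ?thesis
        by (simp add: P matrix_vector_mul_assoc)
    qed
  qed simp
qed

text \<open>Products of at least \<open>k\<close> factors push the whole space V_k down to V_0 = 0.
  The bound \<open>j \<ge> 1\<close> is separate because \<open>k\<close> is 0 when n = 1.\<close>

lemma set_power_subset_flag_semigroup:
  fixes Vs :: "(real ^ 'n) set list"
  assumes Vs: "Vs \<in> flags sum_zero_space k" and "j \<ge> 1" "k \<le> j"
    and "T \<subseteq> flag_semigroup Vs" "T \<noteq> {}"
  shows "set_power (**) T j = {uniform_matrix}"
proof -
  have "P = uniform_matrix" if P: "P \<in> set_power (**) T j" for P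
  proof (rule doubly_stochastic_eq_uniform)
    show "P \<in> doubly_stochastic"
      using set_power_subset_carrier[OF semigroup_with_zero_doubly_stochastic] P assms(4)
        flag_semigroup_subset by blast
    show "P *v x = 0" if "x \<in> sum_zero_space" for x
      using set_power_flag_semigroup_mult[OF Vs \<open>j \<ge> 1\<close>, of k P x] P that assms
        set_power_mono[OF assms(4)] flags_last[OF Vs] flags_first[OF Vs] by auto
  qed
  then show ?thesis
    using set_power_nonempty[OF \<open>T \<noteq> {}\<close> \<open>j \<ge> 1\<close>] by fast
qed

lemma subsemigroup_flag_semigroup:
  fixes Vs :: "(real ^ 'n) set list"
  assumes Vs: "Vs \<in> flags sum_zero_space k"
  shows "subsemigroup doubly_stochastic (**) (flag_semigroup Vs)"
proof -
  have S: "semigroup_with_zero doubly_stochastic (**) (uniform_matrix :: real ^ 'n ^ 'n)"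
    by (rule semigroup_with_zero_doubly_stochastic)
  have V: "Vs ! i \<subseteq> sum_zero_space" if "i \<le> k" for i
    using flags_mono[OF Vs that] flags_last[OF Vs] by simp
  have "uniform_matrix \<in> flag_semigroup Vs"
  proof (rule flag_semigroupI[OF Vs])
    show "uniform_matrix \<in> (doubly_stochastic :: (real ^ 'n ^ 'n) set)"
      using S by (simp add: semigroup_with_zero_def)
    show "uniform_matrix *v x \<in> Vs ! i" if "i < k" "x \<in> Vs ! Suc i" for i x
      using that V[of "Suc i"] uniform_matrix_mult_sum_zero[of x] flags_subspace[OF Vs, of i]
      by (auto simp: subspace_0)
  qed
  moreover have "A ** B \<in> flag_semigroup Vs"
    if A: "A \<in> flag_semigroup Vs" and B: "B \<in> flag_semigroup Vs" for A B
  proof (rule flag_semigroupI[OF Vs])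
    show "A ** B \<in> doubly_stochastic"
      using S A B flag_semigroup_subset[of Vs] unfolding semigroup_with_zero_def by blast
    show "(A ** B) *v x \<in> Vs ! i" if "i < k" "x \<in> Vs ! Suc i" for i x
    proof -
      have "B *v x \<in> Vs ! Suc i"
        using flag_semigroupD[OF Vs B that] flags_step[OF Vs \<open>i < k\<close>] by auto
      then show ?thesis
        using flag_semigroupD[OF Vs A \<open>i < k\<close>] by (simp flip: matrix_vector_mul_assoc)
    qed
  qed
  ultimately show ?thesis
    using flag_semigroup_subset by (auto simp: subsemigroup_def)
qed

section \<open>Refinement of flags\<close>

text \<open>A flag shorter than the dimension has a step of codimension at least 2, where a subspace
  W fits strictly between. Inserting it enlarges the semigroup, since matrices sending V_(i+1) into
  V_i also send V_(i+1) into W and W into V_i.\<close>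

lemma flag_refine:
  fixes Vs :: "(real ^ 'n) set list"
  assumes Vs: "Vs \<in> flags sum_zero_space k" and k: "k < dim (sum_zero_space :: (real ^ 'n) set)"
  obtains Ws where "Ws \<in> flags sum_zero_space (Suc k)" "flag_semigroup Vs \<subseteq> flag_semigroup Ws"
proof -
  \<comment> \<open>If every step raised the dimension by at most one, the whole space would have
    dimension at most \<open>k\<close>.\<close>
  obtain i where i: "i < k" "Suc (dim (Vs ! i)) < dim (Vs ! Suc i)"
  proof (rule ccontr)
    assume "\<not> thesis"
    with that have small: "dim (Vs ! Suc i) \<le> Suc (dim (Vs ! i))" if "i < k" for i
      using \<open>i < k\<close> not_le by blast
    have "dim (Vs ! i) \<le> i" if "i \<le> k" for i
      using that
    proof (induction i)
      case 0
      then show ?case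
        using flags_first[OF Vs] by simp
    next
      case (Suc i)
      then show ?case
        using small[of i] by simp
    qed
    then show False
      using k flags_last[OF Vs] by fastforce
  qed
  obtain x where x: "x \<in> Vs ! Suc i" "x \<notin> Vs ! i"
    using flags_step[OF Vs i(1)] by auto
  define W where "W = span (insert x (Vs ! i))"
  have si: "subspace (Vs ! i)" and sSi: "subspace (Vs ! Suc i)"
    using flags_subspace[OF Vs] i by auto
  have xW: "x \<in> W" and ViW: "Vs ! i \<subseteq> W"
    by (auto simp: W_def intro: span_base)
  have "W \<subseteq> Vs ! Suc i"
    unfolding W_def using x flags_step[OF Vs i(1)] by (intro span_minimal sSi) auto
  moreover have "dim W \<le> Suc (dim (Vs ! i))"
    by (simp add: W_def dim_insert)
  ultimately have W: "Vs ! i \<subset> W" "W \<subset> Vs ! Suc i"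
    using x xW ViW i by auto
  \<comment> \<open>\<open>W\<close> takes position i + 1 and all later members move up by
    one.\<close>
  define f where "f j = (if j \<le> i then Vs ! j else if j = Suc i then W else Vs ! (j - 1))" for j
  define Ws where "Ws = map f [0..<Suc (Suc k)]"
  have f_step: "f j \<subset> f (Suc j)" if j: "j < Suc k" for j
  proof -
    consider "j < i" | "j = i" | "j = Suc i" | "j > Suc i"
      by linarith
    then show ?thesis
    proof cases
      case 4
      then show ?thesis
        using flags_step[OF Vs, of "j - 1"] j by (simp add: f_def)
    qed (use W flags_step[OF Vs, of j] i in \<open>auto simp: f_def\<close>)
  qed
  have "subspace (f j)" if "j \<le> Suc k" for j
    using flags_subspace[OF Vs] that i by (auto simp: f_def W_def)
  then have Ws: "Ws \<in> flags sum_zero_space (Suc k)"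
    unfolding Ws_def
    using f_step i flags_first[OF Vs] flags_last[OF Vs]
    by (intro map_in_flagsI) (auto simp: f_def)
  have nth: "Ws ! j = f j" if "j \<le> Suc k" for j
    using that unfolding Ws_def by (subst nth_map) (auto simp del: upt_Suc)
  have "flag_semigroup Vs \<subseteq> flag_semigroup Ws"
  proof
    fix A assume A: "A \<in> flag_semigroup Vs"
    show "A \<in> flag_semigroup Ws"
    proof (rule flag_semigroupI[OF Ws])
      show "A \<in> doubly_stochastic"
        using A flag_semigroup_subset by auto
      fix j y assume j: "j < Suc k" and "y \<in> Ws ! Suc j"
      then have y: "y \<in> f (Suc j)"
        using nth by simp
      consider "j < i" | "j = i" | "j = Suc i" | "j > Suc i"
        by linarith
      \<comment> \<open>Only two cases involve \<open>W\<close>: for j = i the vector is in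
        \<open>W\<close>, inside V_(i+1), and goes to V_i; for j = i + 1 it is in V_(i+1) and goes
        to V_i, inside \<open>W\<close>.\<close>
      then have "A *v y \<in> f j"
      proof cases
        case 1
        then show ?thesis
          using y flag_semigroupD[OF Vs A, of j y] i by (simp add: f_def)
      next
        case 2
        then show ?thesis
          using y flag_semigroupD[OF Vs A, of i y] i W by (auto simp: f_def)
      next
        case 3
        then show ?thesis
          using y flag_semigroupD[OF Vs A, of i y] i W by (auto simp: f_def)
      next
        case 4
        then show ?thesis
          using y flag_semigroupD[OF Vs A, of "j - 1" y] j by (simp add: f_def)
      qed
      then show "A *v y \<in> Ws ! j"
        using nth j by simp
    qed
  qed
  then show ?thesis
    using that Ws by blast
qed

lemma flag_refine_length:
  fixes Vs :: "(real ^ 'n) set list"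
  assumes Vs: "Vs \<in> flags sum_zero_space m"
    and "m \<le> k" "k \<le> dim (sum_zero_space :: (real ^ 'n) set)"
  shows "\<exists>Ws \<in> flags sum_zero_space k. flag_semigroup Vs \<subseteq> flag_semigroup Ws"
  using assms(2,3)
proof (induction k rule: dec_induct)
  case base
  then show ?case
    using Vs by blast
next
  case (step k)
  then obtain Ws where Ws: "Ws \<in> flags sum_zero_space k" "flag_semigroup Vs \<subseteq> flag_semigroup Ws"
    by auto
  from flag_refine[OF Ws(1)] step.prems
  obtain Us where "Us \<in> flags sum_zero_space (Suc k)" "flag_semigroup Ws \<subseteq> flag_semigroup Us"
    by auto
  with Ws show ?case
    by blast
qed

section \<open>The flag of a nilpotent set of matrices\<close>

lemma nilpotent_subset_flag_semigroup:
  fixes T :: "(real ^ 'n ^ 'n) set"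
  assumes T: "T \<subseteq> doubly_stochastic" and r: "r \<ge> 1" "set_power (**) T r = {uniform_matrix}"
  obtains m Vs where "m \<le> r" "Vs \<in> flags sum_zero_space m" "T \<subseteq> flag_semigroup Vs"
proof -
  \<comment> \<open>Level 0 is set by hand: the dummy value \<open>set_power m T 0 = {}\<close>
    would impose no condition and give the whole space instead of zero.\<close>
  define K :: "nat \<Rightarrow> (real ^ 'n) set" where
    "K i = (if i = 0 then {0} else {v \<in> sum_zero_space. \<forall>P\<in>set_power (**) T i. P *v v = 0})" for i
  have sub: "subspace (K i)" for i
    using subspace_sum_zero_space
    by (auto simp: K_def subspace_def matrix_vector_right_distrib matrix_vector_mult_scaleR)
  \<comment> \<open>This recursion drives everything: it shows that \<open>T\<close> lowers levels,
    that the chain ascends, and that it stays constant after its first repetition.\<close>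
  have K_Suc: "v \<in> K (Suc i) \<longleftrightarrow> v \<in> sum_zero_space \<and> (\<forall>A\<in>T. A *v v \<in> K i)" for i v
  proof (cases "i = 0")
    case False
    then show ?thesis
      using doubly_stochastic_mult_sum_zero[of _ v] T
      by (auto simp: K_def set_power_Suc matrix_vector_mul_assoc subset_iff)
         (metis matrix_vector_mul_assoc)
  qed (simp add: K_def)
  have mono: "K i \<subseteq> K (Suc i)" for i
  proof (induction i)
    case 0
    then show ?case
      using subspace_0[OF sub[of "Suc 0"]] by (auto simp: K_def)
  next
    case (Suc i)
    then show ?case
      using K_Suc by blast
  qed
  have Kr: "K r = sum_zero_space"
    using r uniform_matrix_mult_sum_zero by (auto simp: K_def)
  define m where "m = (LEAST i. K i = sum_zero_space)"
  have m: "K m = sum_zero_space" "m \<le> r" "\<And>i. i < m \<Longrightarrow> K i \<noteq> sum_zero_space"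
    unfolding m_def
    using LeastI[where P = "\<lambda>i. K i = sum_zero_space", OF Kr]
      Least_le[where P = "\<lambda>i. K i = sum_zero_space", OF Kr]
      not_less_Least[where P = "\<lambda>i. K i = sum_zero_space"] by blast+
  \<comment> \<open>A repetition before \<open>m\<close> would freeze the chain at a proper
    subspace, yet it reaches the whole space at \<open>m\<close>.\<close>
  have strict: "K i \<subset> K (Suc i)" if "i < m" for i
  proof (rule ccontr)
    assume "\<not> ?thesis"
    then have eq: "K (Suc i) = K i"
      using mono by blast
    have "K j = K i" if "i \<le> j" for j
      using that
    proof (induction j rule: dec_induct)
      case (step j)
      then have "K (Suc j) = K (Suc i)"
        by (auto simp: K_Suc)
      then show ?case
        using eq by simp
    qed simp
    then show False
      using m that by (metis less_imp_le)
  qed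
  define Vs where "Vs = map K [0..<Suc m]"
  have Vs: "Vs \<in> flags sum_zero_space m"
    unfolding Vs_def using sub m strict by (intro map_in_flagsI) (auto simp: K_def)
  have nth: "Vs ! j = K j" if "j \<le> m" for j
    using that unfolding Vs_def by (subst nth_map) (auto simp del: upt_Suc)
  have "T \<subseteq> flag_semigroup Vs"
    using T K_Suc by (auto intro!: flag_semigroupI[OF Vs] simp: nth)
  then show ?thesis
    using that m Vs by blast
qed

section \<open>From flags to maximal nilpotent subsemigroups\<close>

lemma nilpotency_class_props:
  assumes "nilpotent_subsemigroup S m z T"
  shows "nilpotency_class m z T \<ge> 1" "set_power m T (nilpotency_class m z T) = {z}"
proof -
  have "\<exists>k. k \<ge> 1 \<and> set_power m T k = {z}"
    using assms by (auto simp: nilpotent_subsemigroup_def)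
  from LeastI_ex[OF this] show "nilpotency_class m z T \<ge> 1" "set_power m T (nilpotency_class m z T) = {z}"
    by (auto simp: nilpotency_class_def)
qed

lemma nilpotency_class_le:
  "j \<ge> 1 \<Longrightarrow> set_power m T j = {z} \<Longrightarrow> nilpotency_class m z T \<le> j"
  by (simp add: nilpotency_class_def Least_le)

lemma flag_semigroup_in_Nil_class:
  fixes Vs :: "(real ^ 'n) set list"
  assumes Vs: "Vs \<in> flags sum_zero_space k" and "j \<ge> 1" "k \<le> j"
  shows "flag_semigroup Vs \<in> Nil_class doubly_stochastic (**) uniform_matrix j"
proof -
  have s: "subsemigroup doubly_stochastic (**) (flag_semigroup Vs)"
    by (rule subsemigroup_flag_semigroup[OF Vs])
  then have "set_power (**) (flag_semigroup Vs) j = {uniform_matrix}"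
    using set_power_subset_flag_semigroup[OF assms] by (simp add: subsemigroup_def)
  then show ?thesis
    using s \<open>j \<ge> 1\<close> by (auto simp: Nil_class_def nilpotent_subsemigroup_def intro: nilpotency_class_le)
qed

lemma nilpotent_in_flag_semigroup:
  fixes T :: "(real ^ 'n ^ 'n) set"
  assumes T: "nilpotent_subsemigroup doubly_stochastic (**) uniform_matrix T"
  obtains m Vs where "m \<le> nilpotency_class (**) uniform_matrix T"
    "m \<le> dim (sum_zero_space :: (real ^ 'n) set)"
    "Vs \<in> flags sum_zero_space m" "T \<subseteq> flag_semigroup Vs"
proof -
  have "T \<subseteq> doubly_stochastic"
    using T by (simp add: nilpotent_subsemigroup_def subsemigroup_def)
  then obtain m Vs where "m \<le> nilpotency_class (**) uniform_matrix T"
    "Vs \<in> flags sum_zero_space m" "T \<subseteq> flag_semigroup Vs"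
    by (rule nilpotent_subset_flag_semigroup[OF _ nilpotency_class_props[OF T]])
  then show ?thesis
    using that flags_length_le_dim by blast
qed

text \<open>Abstracts what the bounded-class and the unbounded case share: the family contains the
  semigroups of all flags of length \<open>k\<close>, and each member lies below one of them.
  Inclusion forcing equality of flags then gives injectivity and maximality.\<close>

lemma bij_betw_flag_semigroup_maximal:
  fixes \<C> :: "(real ^ 'n ^ 'n) set set"
  assumes in_C: "\<And>Vs. Vs \<in> flags sum_zero_space k \<Longrightarrow> flag_semigroup Vs \<in> \<C>"
    and below: "\<And>T. T \<in> \<C> \<Longrightarrow> \<exists>Vs \<in> flags sum_zero_space k. T \<subseteq> flag_semigroup Vs"
  shows "bij_betw flag_semigroup (flags sum_zero_space k) (maximal_elements \<C>)"
proof (rule bij_betw_imageI)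
  show "inj_on flag_semigroup (flags sum_zero_space k :: (real ^ 'n) set list set)"
    using flag_semigroup_subset_imp_eq by (intro inj_onI) blast
  show "flag_semigroup ` flags sum_zero_space k = maximal_elements \<C>"
  proof (intro equalityI subsetI)
    fix T :: "(real ^ 'n ^ 'n) set"
    assume "T \<in> flag_semigroup ` flags sum_zero_space k"
    then obtain Vs where Vs: "Vs \<in> flags sum_zero_space k" "T = flag_semigroup Vs"
      by blast
    have "U = T" if U: "U \<in> \<C>" "T \<subseteq> U" for U
    proof -
      obtain Ws where Ws: "Ws \<in> flags sum_zero_space k" "U \<subseteq> flag_semigroup Ws"
        using below[OF U(1)] by blast
      then have "Vs = Ws"
        using U Vs by (intro flag_semigroup_subset_imp_eq) auto
      then show ?thesis
        using U Vs Ws by blast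
    qed
    then show "T \<in> maximal_elements \<C>"
      using in_C Vs by (auto simp: maximal_elements_def)
  next
    fix T :: "(real ^ 'n ^ 'n) set"
    assume T: "T \<in> maximal_elements \<C>"
    then have "T \<in> \<C>"
      by (simp add: maximal_elements_def)
    then obtain Vs where "Vs \<in> flags sum_zero_space k" "T \<subseteq> flag_semigroup Vs"
      using below by blast
    then show "T \<in> flag_semigroup ` flags sum_zero_space k"
      using T in_C by (auto simp: maximal_elements_def)
  qed
qed

text \<open>A semigroup of class at most \<open>k\<close> lies in that of a flag of length at most
  \<open>k\<close>, which refines to length exactly \<open>k\<close> because \<open>k\<close> does
  not exceed the dimension.\<close>

lemma bij_betw_flags_Nil_class:
  assumes k: "k \<ge> 1" "k \<le> dim (sum_zero_space :: (real ^ 'n) set)"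
  shows "bij_betw flag_semigroup (flags (sum_zero_space :: (real ^ 'n) set) k)
    (maximal_elements (Nil_class doubly_stochastic (**) uniform_matrix k))"
proof (rule bij_betw_flag_semigroup_maximal)
  fix T :: "(real ^ 'n ^ 'n) set"
  assume "T \<in> Nil_class doubly_stochastic (**) uniform_matrix k"
  then have "nilpotent_subsemigroup doubly_stochastic (**) uniform_matrix T"
    "nilpotency_class (**) uniform_matrix T \<le> k"
    by (auto simp: Nil_class_def)
  then obtain m Vs where "m \<le> k" "Vs \<in> flags sum_zero_space m" "T \<subseteq> flag_semigroup Vs"
    by (meson nilpotent_in_flag_semigroup order_trans)
  then show "\<exists>Vs \<in> flags sum_zero_space k. T \<subseteq> flag_semigroup Vs"
    using flag_refine_length k by (meson order_trans)
qed (use flag_semigroup_in_Nil_class k in auto)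

lemma bij_betw_complete_flags_Nil_all:
  "bij_betw flag_semigroup (complete_flags (sum_zero_space :: (real ^ 'n) set))
    (maximal_elements (Nil_all doubly_stochastic (**) uniform_matrix))"
  unfolding complete_flags_def
proof (rule bij_betw_flag_semigroup_maximal)
  let ?d = "dim (sum_zero_space :: (real ^ 'n) set)"
  show "flag_semigroup Vs \<in> Nil_all doubly_stochastic (**) uniform_matrix"
    if "Vs \<in> flags sum_zero_space ?d" for Vs :: "(real ^ 'n) set list"
    \<comment> \<open>The maximum covers n = 1, where the dimension is 0 while nilpotency classes
      start at 1.\<close>
    using flag_semigroup_in_Nil_class[OF that, of "max 1 ?d"]
    unfolding Nil_all_def by (auto intro!: bexI[of _ "max 1 ?d"])
  fix T :: "(real ^ 'n ^ 'n) set"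
  assume "T \<in> Nil_all doubly_stochastic (**) uniform_matrix"
  then have "nilpotent_subsemigroup doubly_stochastic (**) uniform_matrix T"
    by (auto simp: Nil_all_def Nil_class_def)
  then obtain m Vs where "m \<le> ?d" "Vs \<in> flags sum_zero_space m" "T \<subseteq> flag_semigroup Vs"
    by (rule nilpotent_in_flag_semigroup)
  then show "\<exists>Vs \<in> flags sum_zero_space ?d. T \<subseteq> flag_semigroup Vs"
    using flag_refine_length by (meson order_refl order_trans)
qed

section \<open>The exact nilpotency class\<close>

text \<open>A class below \<open>k\<close> would put the semigroup inside that of a flag of length m
  < k. Comparison from the top places V_(k-m) inside W_0 = 0, impossible for a member above
  V_0.\<close>

lemma nilpotency_class_flag_semigroup:
  fixes Vs :: "(real ^ 'n) set list"
  assumes Vs: "Vs \<in> flags sum_zero_space k" and k: "k \<ge> 1"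
  shows "nilpotency_class (**) uniform_matrix (flag_semigroup Vs) = k"
proof -
  let ?c = "nilpotency_class (**) uniform_matrix (flag_semigroup Vs)"
  have N: "nilpotent_subsemigroup doubly_stochastic (**) uniform_matrix (flag_semigroup Vs)"
    and le: "?c \<le> k"
    using flag_semigroup_in_Nil_class[OF Vs k] by (auto simp: Nil_class_def)
  obtain m Ws where m: "m \<le> ?c" and Ws: "Ws \<in> flags sum_zero_space m"
    and sub: "flag_semigroup Vs \<subseteq> flag_semigroup Ws"
    by (rule nilpotent_in_flag_semigroup[OF N])
  have "Vs ! (k - m) \<subseteq> Ws ! 0"
    using flag_semigroup_subset_nth[OF Vs Ws sub, of m] m le by simp
  then have "Vs ! (k - m) \<subseteq> {0}"
    using flags_first[OF Ws] by simp
  have "k - m = 0"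
  proof (rule ccontr)
    assume "k - m \<noteq> 0"
    then have "Vs ! Suc 0 \<subseteq> Vs ! (k - m)"
      by (intro flags_mono[OF Vs]) auto
    moreover have "Vs ! 0 \<subset> Vs ! Suc 0"
      using k by (intro flags_step[OF Vs]) simp
    ultimately show False
      using \<open>Vs ! (k - m) \<subseteq> {0}\<close> flags_first[OF Vs] by (metis psubsetE subset_trans)
  qed
  then show ?thesis
    using m le by simp
qed

lemma nilpotency_class_le_dim:
  fixes T :: "(real ^ 'n ^ 'n) set"
  assumes T: "nilpotent_subsemigroup doubly_stochastic (**) uniform_matrix T"
  shows "nilpotency_class (**) uniform_matrix T \<le> max 1 (dim (sum_zero_space :: (real ^ 'n) set))"
proof -
  obtain m Vs where m: "m \<le> dim (sum_zero_space :: (real ^ 'n) set)"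
    "Vs \<in> flags sum_zero_space m" "T \<subseteq> flag_semigroup Vs"
    by (rule nilpotent_in_flag_semigroup[OF T])
  have "T \<noteq> {}"
    using T by (simp add: nilpotent_subsemigroup_def subsemigroup_def)
  then show ?thesis
    using m by (intro nilpotency_class_le set_power_subset_flag_semigroup[OF m(2)]) auto
qed

text \<open>Maximality of class \<open>k\<close> is read in two ways: maximal in
  \<open>Nil_class\<close> for \<open>k\<close>, or in addition of class exactly \<open>k\<close>.
  The first is restricted to k at most n - 1, since beyond that no flag of length \<open>k\<close>
  exists although maximal elements do. The second holds for all \<open>k\<close> once n is at least
  2; for n = k = 1 the zero semigroup has class 1 but there is no flag of length 1.\<close>

theorem corollary4p8:
  fixes k :: nat
    and V :: "(real ^ 'n) set"
    and D :: "(real ^ 'n ^ 'n) set"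
    and O\<^sub>n :: "real ^ 'n ^ 'n"
  assumes "k \<ge> 1"
    and "V = sum_zero_space"
    and "D = doubly_stochastic"
    and "O\<^sub>n = uniform_matrix"
  shows "dim V = CARD('n) - 1 \<and>
    (k \<le> CARD('n) - 1 \<longrightarrow>
       bij_betw flag_semigroup (flags V k) (maximal_elements (Nil_class D (**) O\<^sub>n k))) \<and>
    (CARD('n) \<ge> 2 \<longrightarrow>
       bij_betw flag_semigroup (flags V k)
         {T \<in> maximal_elements (Nil_class D (**) O\<^sub>n k). nilpotency_class (**) O\<^sub>n T = k}) \<and>
    bij_betw flag_semigroup (complete_flags V) (maximal_elements (Nil_all D (**) O\<^sub>n))"
proof -
  have d: "dim V = CARD('n) - 1"
    using assms(2) dim_sum_zero_space by simp
  have le: "bij_betw flag_semigroup (flags V k) (maximal_elements (Nil_class D (**) O\<^sub>n k))"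
    if "k \<le> CARD('n) - 1"
    using bij_betw_flags_Nil_class assms that d by metis
  have "bij_betw flag_semigroup (flags V k)
      {T \<in> maximal_elements (Nil_class D (**) O\<^sub>n k). nilpotency_class (**) O\<^sub>n T = k}"
    if n: "CARD('n) \<ge> 2"
  proof (cases "k \<le> CARD('n) - 1")
    case True
    have "nilpotency_class (**) O\<^sub>n T = k" if "T \<in> maximal_elements (Nil_class D (**) O\<^sub>n k)" for T
    proof -
      from that obtain Vs where "Vs \<in> flags sum_zero_space k" "T = flag_semigroup Vs"
        unfolding bij_betw_imp_surj_on[OF le[OF True], symmetric] assms(2) by (rule imageE)
      then show ?thesis
        using nilpotency_class_flag_semigroup assms by simp
    qed
    then have "{T \<in> maximal_elements (Nil_class D (**) O\<^sub>n k). nilpotency_class (**) O\<^sub>n T = k}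
        = maximal_elements (Nil_class D (**) O\<^sub>n k)"
      by blast
    then show ?thesis
      using le[OF True] by simp
  next
    case False
    \<comment> \<open>For k > n - 1 both sides are empty: strict chains and nilpotency classes are
      both bounded by n - 1, the latter because n is at least 2.\<close>
    then have "flags V k = {}"
      using flags_length_le_dim d by fastforce
    moreover have "nilpotency_class (**) O\<^sub>n T \<noteq> k"
      if "T \<in> maximal_elements (Nil_class D (**) O\<^sub>n k)" for T
      using that nilpotency_class_le_dim[of T] False n d assms
      by (auto simp: maximal_elements_def Nil_class_def)
    ultimately show ?thesis
      by (auto simp: bij_betw_def)
  qed
  then show ?thesis
    using d le bij_betw_complete_flags_Nil_all assms by simp
qed

end
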